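(* Let $\mathcal{C}$ be a category and suppose that for each object $a$ of $\mathcal{C}$ there is given a set $I(a)\subseteq \mathrm{Aut}_{\mathcal{C}}(a)$ of automorphisms of $a$ (called inner automorphisms), such that the following axiom holds: for every morphism $f\colon a\to b$ of $\mathcal{C}$ and every $h\in I(a)$ there exists $k\in I(b)$ with $f\circ h = k\circ f$. For each object $a$ let $\mathrm{Inn}(a)$ denote the subgroup of $\mathrm{Aut}_{\mathcal{C}}(a)$ generated by $I(a)$. Then: (1) The family of subgroups $(\mathrm{Inn}(a))_a$ also satisfies the axiom (for every morphism $f\colon a\to b$ and every $h\in \mathrm{Inn}(a)$ there exists $k\in \mathrm{Inn}(b)$ with $f\circ h=k\circ f$), and in particular each $\mathrm{Inn}(a)$ is a normal subgroup of $\mathrm{Aut}_{\mathcal{C}}(a)$. (2) Let $\mathcal{C}^{\mathrm{out}}$ have the same objects as $\mathcal{C}$, and as morphisms from $a$ to $b$ the equivalence classes of morphisms $a\to b$ of $\mathcal{C}$ modulo inner automorphisms, composed by multiplying equivalence classes. Then $\mathcal{C}^{\mathrm{out}}$ is a category, and it is a classifying category for $\mathcal{C}$: the canonical quotient map $\mathcal{C}\to\mathcal{C}^{\mathrm{out}}$ (identity on objects, $f\mapsto [f]$ on morphisms) is a classification functor.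
   Context: Equivalence modulo inner automorphisms: two morphisms $f,g\colon a\to b$ of $\mathcal{C}$ are equivalent if $g = k\circ f\circ h$ for some $h\in \mathrm{Inn}(a)$ and $k\in\mathrm{Inn}(b)$; $[f]$ denotes the equivalence class of $f$. The product of the classes $[f]$ of $f\colon a\to b$ and $[g]$ of $g\colon b\to c$ is the set $\{g'\circ f' : g'\in[g],\ f'\in[f]\}$ (part of the assertion is that this set is a single equivalence class, namely $[g\circ f]$). A functor $F\colon\mathcal{C}\to\mathcal{D}$ is called a classification functor if it distinguishes isomorphism classes: for all objects $a,b$ of $\mathcal{C}$, if $F(a)\cong F(b)$ in $\mathcal{D}$ then $a\cong b$ in $\mathcal{C}$. The codomain category $\mathcal{D}$ is then called a classifying category for $\mathcal{C}$. *)

theory Defs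
  imports "HOL-Algebra.Generated_Groups"
begin

text \<open>A category is given by its objects, hom-sets, identities and composition, where
  \<open>g \<cdot>\<^bsub>C\<^esub> f\<close> means ``\<open>g\<close> after \<open>f\<close>''. As usual, every morphism determines its
  domain and codomain, i.e. the hom-sets are pairwise disjoint. Values of \<open>\<cdot>\<^bsub>C\<^esub>\<close> on
  non-composable pairs, and identities of non-objects, are irrelevant.\<close>

record ('o, 'm) cat =
  Obj :: "'o set"
  Hom :: "'o \<Rightarrow> 'o \<Rightarrow> 'm set"
  Ident :: "'o \<Rightarrow> 'm"
  Comp :: "'m \<Rightarrow> 'm \<Rightarrow> 'm"  (infixl \<open>\<cdot>\<index>\<close> 70)

locale category =
  fixes C :: "('o, 'm) cat" (structure)
  assumes Hom_Obj: "f \<in> Hom C a b \<Longrightarrow> a \<in> Obj C \<and> b \<in> Obj C"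
    and Hom_unique: "f \<in> Hom C a b \<Longrightarrow> f \<in> Hom C a' b' \<Longrightarrow> a = a' \<and> b = b'"
    and Ident_Hom: "a \<in> Obj C \<Longrightarrow> Ident C a \<in> Hom C a a"
    and Comp_Hom: "f \<in> Hom C a b \<Longrightarrow> g \<in> Hom C b c \<Longrightarrow> g \<cdot> f \<in> Hom C a c"
    and Comp_assoc: "f \<in> Hom C a b \<Longrightarrow> g \<in> Hom C b c \<Longrightarrow> h \<in> Hom C c d \<Longrightarrow>
          (h \<cdot> g) \<cdot> f = h \<cdot> (g \<cdot> f)"
    and Comp_Ident_right: "f \<in> Hom C a b \<Longrightarrow> f \<cdot> Ident C a = f"
    and Comp_Ident_left: "f \<in> Hom C a b \<Longrightarrow> Ident C b \<cdot> f = f"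

definition Mor :: "('o, 'm) cat \<Rightarrow> 'm set" where
  "Mor C = (\<Union>a\<in>Obj C. \<Union>b\<in>Obj C. Hom C a b)"

definition Iso :: "('o, 'm) cat \<Rightarrow> 'o \<Rightarrow> 'o \<Rightarrow> 'm set" where
  "Iso C a b = {f \<in> Hom C a b. \<exists>g\<in>Hom C b a. g \<cdot>\<^bsub>C\<^esub> f = Ident C a \<and> f \<cdot>\<^bsub>C\<^esub> g = Ident C b}"

definition isomorphic :: "('o, 'm) cat \<Rightarrow> 'o \<Rightarrow> 'o \<Rightarrow> bool" where
  "isomorphic C a b \<longleftrightarrow> Iso C a b \<noteq> {}"

definition Aut :: "('o, 'm) cat \<Rightarrow> 'o \<Rightarrow> 'm monoid" where
  "Aut C a = \<lparr>carrier = Iso C a a, mult = Comp C, one = Ident C a\<rparr>"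

locale cat_functor = dom: category C + cod: category D
  for C :: "('o, 'm) cat" and D :: "('p, 'n) cat" +
  fixes F_ob :: "'o \<Rightarrow> 'p" and F_mor :: "'m \<Rightarrow> 'n"
  assumes F_ob_Obj: "a \<in> Obj C \<Longrightarrow> F_ob a \<in> Obj D"
    and F_mor_Hom: "f \<in> Hom C a b \<Longrightarrow> F_mor f \<in> Hom D (F_ob a) (F_ob b)"
    and F_mor_Ident: "a \<in> Obj C \<Longrightarrow> F_mor (Ident C a) = Ident D (F_ob a)"
    and F_mor_Comp: "f \<in> Hom C a b \<Longrightarrow> g \<in> Hom C b c \<Longrightarrow>
          F_mor (g \<cdot>\<^bsub>C\<^esub> f) = F_mor g \<cdot>\<^bsub>D\<^esub> F_mor f"

locale classification_functor = cat_functor +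
  assumes distinguishes_iso_classes: "a \<in> Obj C \<Longrightarrow> b \<in> Obj C \<Longrightarrow>
    isomorphic D (F_ob a) (F_ob b) \<Longrightarrow> isomorphic C a b"

definition classifying_category :: "('o, 'm) cat \<Rightarrow> ('p, 'n) cat \<Rightarrow> bool" where
  "classifying_category C D \<longleftrightarrow> (\<exists>F_ob F_mor. classification_functor C D F_ob F_mor)"

definition inner_axiom :: "('o, 'm) cat \<Rightarrow> ('o \<Rightarrow> 'm set) \<Rightarrow> bool" where
  "inner_axiom C I \<longleftrightarrow>
    (\<forall>a\<in>Obj C. \<forall>b\<in>Obj C. \<forall>f\<in>Hom C a b. \<forall>h\<in>I a. \<exists>k\<in>I b. f \<cdot>\<^bsub>C\<^esub> h = k \<cdot>\<^bsub>C\<^esub> f)"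

definition Inn :: "('o, 'm) cat \<Rightarrow> ('o \<Rightarrow> 'm set) \<Rightarrow> 'o \<Rightarrow> 'm set" where
  "Inn C I a = generate (Aut C a) (I a)"

definition inner_equiv :: "('o, 'm) cat \<Rightarrow> ('o \<Rightarrow> 'm set) \<Rightarrow> ('m \<times> 'm) set" where
  "inner_equiv C I = {(f, g). \<exists>a\<in>Obj C. \<exists>b\<in>Obj C. f \<in> Hom C a b \<and> g \<in> Hom C a b \<and>
     (\<exists>h\<in>Inn C I a. \<exists>k\<in>Inn C I b. g = k \<cdot>\<^bsub>C\<^esub> f \<cdot>\<^bsub>C\<^esub> h)}"

definition inner_class :: "('o, 'm) cat \<Rightarrow> ('o \<Rightarrow> 'm set) \<Rightarrow> 'm \<Rightarrow> 'm set" where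
  "inner_class C I f = inner_equiv C I `` {f}"

definition class_prod :: "('o, 'm) cat \<Rightarrow> 'm set \<Rightarrow> 'm set \<Rightarrow> 'm set" where
  "class_prod C G F = {g \<cdot>\<^bsub>C\<^esub> f | g f. g \<in> G \<and> f \<in> F}"

definition Out :: "('o, 'm) cat \<Rightarrow> ('o \<Rightarrow> 'm set) \<Rightarrow> ('o, 'm set) cat" where
  "Out C I =
    \<lparr>Obj = Obj C,
     Hom = (\<lambda>a b. Hom C a b // inner_equiv C I),
     Ident = (\<lambda>a. inner_class C I (Ident C a)),
     Comp = class_prod C\<rparr>"

end

theory Submission
  imports Defs
begin

text \<open>The axiom lets an inner automorphism of the source be moved across a morphism to the
  target, hence \<open>[f]\<close> is simply \<open>{k \<cdot> f | k \<in> Inn b}\<close>; inner factors can therefore always be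
  collected on the left, so classes multiply well. If \<open>[f]\<close> and \<open>[g]\<close> are inverse to each
  other in the quotient, then \<open>g \<cdot> f\<close> and \<open>f \<cdot> g\<close> are inner automorphisms, so \<open>f\<close> has a left and
  a right inverse and is an isomorphism.\<close>

section \<open>Isomorphisms and automorphism groups of a category\<close>

context category
begin

lemma Iso_Hom: "f \<in> Iso C a b \<Longrightarrow> f \<in> Hom C a b"
  by (simp add: Iso_def)

text \<open>Needed because lifting an inverse from the quotient yields a left and a right inverse
  that are corrected by different inner automorphisms and not visibly equal. Associativity of
  \<open>g \<cdot> f \<cdot> g'\<close> forces them to agree.\<close>

lemma Iso_if_left_right_inverse:
  assumes f: "f \<in> Hom C a b" and g: "g \<in> Hom C b a" and g': "g' \<in> Hom C b a"
    and gf: "g \<cdot> f = Ident C a" and fg': "f \<cdot> g' = Ident C b"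
  shows "f \<in> Iso C a b"
proof -
  have "g = g \<cdot> (f \<cdot> g')"
    using g fg' Comp_Ident_right by simp
  also have "\<dots> = (g \<cdot> f) \<cdot> g'"
    using Comp_assoc[OF g' f g] by simp
  also have "\<dots> = g'"
    using gf g' Comp_Ident_left by simp
  finally show ?thesis
    using f g gf fg' unfolding Iso_def by auto
qed

lemma Ident_Iso: "a \<in> Obj C \<Longrightarrow> Ident C a \<in> Iso C a a"
  unfolding Iso_def using Ident_Hom Comp_Ident_left by auto

lemma Iso_Comp:
  assumes "f \<in> Iso C a b" "g \<in> Iso C b c"
  shows "g \<cdot> f \<in> Iso C a c"
proof -
  obtain f' where f: "f \<in> Hom C a b" and f': "f' \<in> Hom C b a"
    and ff: "f' \<cdot> f = Ident C a" "f \<cdot> f' = Ident C b"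
    using assms(1) by (auto simp: Iso_def)
  obtain g' where g: "g \<in> Hom C b c" and g': "g' \<in> Hom C c b"
    and gg: "g' \<cdot> g = Ident C b" "g \<cdot> g' = Ident C c"
    using assms(2) by (auto simp: Iso_def)
  have gf: "g \<cdot> f \<in> Hom C a c" and fg: "f' \<cdot> g' \<in> Hom C c a"
    using f g f' g' Comp_Hom by blast+
  have "(f' \<cdot> g') \<cdot> (g \<cdot> f) = f' \<cdot> ((g' \<cdot> g) \<cdot> f)"
    using Comp_assoc[OF gf g' f'] Comp_assoc[OF f g g'] by simp
  then have 1: "(f' \<cdot> g') \<cdot> (g \<cdot> f) = Ident C a"
    using gg ff Comp_Ident_left[OF f] by simp
  have "(g \<cdot> f) \<cdot> (f' \<cdot> g') = g \<cdot> ((f \<cdot> f') \<cdot> g')"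
    using Comp_assoc[OF fg f g] Comp_assoc[OF g' f' f] by simp
  then have 2: "(g \<cdot> f) \<cdot> (f' \<cdot> g') = Ident C c"
    using gg ff Comp_Ident_left[OF g'] by simp
  from 1 2 gf fg show ?thesis
    unfolding Iso_def by auto
qed

lemma group_Aut:
  assumes "a \<in> Obj C"
  shows "group (Aut C a)"
proof (rule groupI)
  fix x assume "x \<in> carrier (Aut C a)"
  \<comment> \<open>The inverse morphism provided by \<open>Iso_def\<close> is itself an
    automorphism, having \<open>x\<close> as its inverse.\<close>
  then show "\<exists>y\<in>carrier (Aut C a). y \<otimes>\<^bsub>Aut C a\<^esub> x = \<one>\<^bsub>Aut C a\<^esub>"
    by (auto simp: Aut_def Iso_def)
qed (use assms in \<open>auto simp: Aut_def Iso_Comp Ident_Iso Comp_assoc[OF Iso_Hom Iso_Hom Iso_Hom]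
      Comp_Ident_left[OF Iso_Hom]\<close>)

end

section \<open>The subgroups generated by inner automorphisms\<close>

locale inner_category = category C for C :: "('o, 'm) cat" (structure) +
  fixes I :: "'o \<Rightarrow> 'm set"
  assumes inner_Aut: "a \<in> Obj C \<Longrightarrow> I a \<subseteq> carrier (Aut C a)"
    and inner_axiom: "inner_axiom C I"
begin

lemma subgroup_Inn: "a \<in> Obj C \<Longrightarrow> subgroup (Inn C I a) (Aut C a)"
  unfolding Inn_def using group.generate_is_subgroup[OF group_Aut inner_Aut] .

lemma Inn_Hom:
  assumes "a \<in> Obj C" "h \<in> Inn C I a"
  shows "h \<in> Hom C a a"
  using subgroup.mem_carrier[OF subgroup_Inn assms(2)] assms(1) by (auto simp: Aut_def Iso_def)

lemma Inn_Ident: "a \<in> Obj C \<Longrightarrow> Ident C a \<in> Inn C I a"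
  using subgroup.one_closed[OF subgroup_Inn] by (simp add: Aut_def)

lemma Inn_Comp: "a \<in> Obj C \<Longrightarrow> h \<in> Inn C I a \<Longrightarrow> k \<in> Inn C I a \<Longrightarrow> h \<cdot> k \<in> Inn C I a"
  using subgroup.m_closed[OF subgroup_Inn] by (simp add: Aut_def)

text \<open>Turns group inverses into equations in \<open>C\<close>, where they can be composed with
  morphisms that are not automorphisms.\<close>

lemma Inn_inverse:
  assumes "a \<in> Obj C" "h \<in> Inn C I a"
  obtains k where "k \<in> Inn C I a" "k \<cdot> h = Ident C a" "h \<cdot> k = Ident C a"
proof
  interpret group "Aut C a" by (rule group_Aut[OF assms(1)])
  have h: "h \<in> carrier (Aut C a)"
    using subgroup.mem_carrier[OF subgroup_Inn assms(2)] assms(1) by blast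
  show "inv\<^bsub>Aut C a\<^esub> h \<in> Inn C I a"
    using subgroup.m_inv_closed[OF subgroup_Inn] assms by blast
  show "inv\<^bsub>Aut C a\<^esub> h \<cdot> h = Ident C a" "h \<cdot> inv\<^bsub>Aut C a\<^esub> h = Ident C a"
    using l_inv[OF h] r_inv[OF h] by (simp_all add: Aut_def)
qed

lemma Inn_move_generator:
  assumes f: "f \<in> Hom C a b" and h: "h \<in> I a"
  obtains k where "k \<in> Inn C I b" "f \<cdot> h = k \<cdot> f"
proof -
  have "\<exists>k\<in>I b. f \<cdot> h = k \<cdot> f"
    using inner_axiom f h Hom_Obj[OF f] unfolding inner_axiom_def by blast
  then show thesis
    using that generate.incl unfolding Inn_def by metis
qed

text \<open>Induction on how \<open>h\<close> is generated. The identity moves to the identity, and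
  a product moves one factor at a time. For the inverse of a generator,
  \<open>f \<cdot> h = k \<cdot> f\<close> is multiplied by the inverses of \<open>h\<close> and
  \<open>k\<close>. Since \<open>I b\<close> need not be closed under products or inverses, the
  witness is sought in \<open>Inn C I b\<close>.\<close>

lemma Inn_move:
  assumes f: "f \<in> Hom C a b" and h: "h \<in> Inn C I a"
  shows "\<exists>k\<in>Inn C I b. f \<cdot> h = k \<cdot> f"
proof -
  have a: "a \<in> Obj C" and b: "b \<in> Obj C"
    using Hom_Obj[OF f] by auto
  show ?thesis
    using h unfolding Inn_def
  proof (induction h rule: generate.induct)
    case one
    have "f \<cdot> Ident C a = Ident C b \<cdot> f"
      using Comp_Ident_left[OF f] Comp_Ident_right[OF f] by simp
    then show ?case
      using Inn_Ident[OF b] unfolding Inn_def by (auto simp: Aut_def)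
  next
    case (incl h)
    then show ?case
      using Inn_move_generator[OF f, of h] unfolding Inn_def by metis
  next
    case (inv h)
    interpret A: group "Aut C a" by (rule group_Aut[OF a])
    let ?h' = "inv\<^bsub>Aut C a\<^esub> h"
    have hA: "h \<in> carrier (Aut C a)" using inner_Aut[OF a] inv by auto
    have h: "h \<in> Hom C a a" and h': "?h' \<in> Hom C a a"
      using hA A.inv_closed[OF hA] by (auto simp: Aut_def Iso_def)
    have hh': "h \<cdot> ?h' = Ident C a"
      using A.r_inv[OF hA] by (simp add: Aut_def)
    obtain k where k: "k \<in> Inn C I b" "f \<cdot> h = k \<cdot> f"
      using Inn_move_generator[OF f inv] .
    obtain k' where k': "k' \<in> Inn C I b" "k' \<cdot> k = Ident C b"
      using Inn_inverse[OF b k(1)] .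
    note kH = Inn_Hom[OF b k(1)] and k'H = Inn_Hom[OF b k'(1)]
    have fh': "f \<cdot> ?h' \<in> Hom C a b" using Comp_Hom[OF h' f] .
    \<comment> \<open>Cancelling \<open>h\<close> against its inverse gives
      \<open>k \<cdot> (f \<cdot> ?h') = f\<close>; composing with \<open>k'\<close> on the left
      then shows that \<open>k'\<close> is the witness.\<close>
    have "k \<cdot> (f \<cdot> ?h') = (f \<cdot> h) \<cdot> ?h'"
      using k(2) Comp_assoc[OF h' f kH] by simp
    also have "\<dots> = f"
      using Comp_assoc[OF h' h f] hh' Comp_Ident_right[OF f] by simp
    finally have "k' \<cdot> f = k' \<cdot> (k \<cdot> (f \<cdot> ?h'))" by simp
    also have "\<dots> = f \<cdot> ?h'"
      using Comp_assoc[OF fh' kH k'H] k'(2) Comp_Ident_left[OF fh'] by simp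
    finally show ?case
      using k'(1) unfolding Inn_def by metis
  next
    case (eng h1 h2)
    obtain k1 k2 where k: "k1 \<in> Inn C I b" "f \<cdot> h1 = k1 \<cdot> f" "k2 \<in> Inn C I b" "f \<cdot> h2 = k2 \<cdot> f"
      using eng.IH unfolding Inn_def by blast
    have H: "h1 \<in> Hom C a a" "h2 \<in> Hom C a a"
      using eng.hyps Inn_Hom[OF a] by (auto simp: Inn_def)
    note K = Inn_Hom[OF b k(1)] Inn_Hom[OF b k(3)]
    \<comment> \<open>Moving \<open>h1\<close> first and then \<open>h2\<close> keeps the order of
      the factors, so the witness is \<open>k1 \<cdot> k2\<close>.\<close>
    have "f \<cdot> (h1 \<cdot> h2) = k1 \<cdot> (f \<cdot> h2)"
      using Comp_assoc[OF H(2,1) f] Comp_assoc[OF H(2) f K(1)] k(2) by simp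
    also have "\<dots> = (k1 \<cdot> k2) \<cdot> f"
      using Comp_assoc[OF f K(2,1)] k(4) by simp
    finally show ?case
      using Inn_Comp[OF b k(1,3)] unfolding Inn_def by (auto simp: Aut_def)
  qed
qed

lemma inner_axiom_Inn: "inner_axiom C (Inn C I)"
  unfolding inner_axiom_def using Inn_move by blast

text \<open>The axiom for an automorphism \<open>x\<close> gives
  \<open>x \<cdot> h = k \<cdot> x\<close>, so the conjugate of \<open>h\<close> by \<open>x\<close>
  is \<open>k\<close>.\<close>

lemma normal_Inn:
  assumes a: "a \<in> Obj C"
  shows "Inn C I a \<lhd> Aut C a"
proof -
  interpret group "Aut C a" by (rule group_Aut[OF a])
  have "x \<otimes>\<^bsub>Aut C a\<^esub> h \<otimes>\<^bsub>Aut C a\<^esub> inv\<^bsub>Aut C a\<^esub> x \<in> Inn C I a"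
    if x: "x \<in> carrier (Aut C a)" and h: "h \<in> Inn C I a" for x h
  proof -
    obtain k where k: "k \<in> Inn C I a" "x \<otimes>\<^bsub>Aut C a\<^esub> h = k \<otimes>\<^bsub>Aut C a\<^esub> x"
      using Inn_move[of x a a h] x h by (auto simp: Aut_def Iso_def)
    have "k \<in> carrier (Aut C a)"
      using subgroup.mem_carrier[OF subgroup_Inn[OF a] k(1)] .
    then show ?thesis
      using k x by (simp add: m_assoc)
  qed
  then show ?thesis
    using normal_inv_iff subgroup_Inn[OF a] by blast
qed

section \<open>Equivalence modulo inner automorphisms and products of classes\<close>

lemma inner_equiv_iff:
  assumes f: "f \<in> Hom C a b"
  shows "(f, g) \<in> inner_equiv C I \<longleftrightarrow> (\<exists>k\<in>Inn C I b. g = k \<cdot> f)"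
proof
  assume "(f, g) \<in> inner_equiv C I"
  then obtain a' b' h k where "f \<in> Hom C a' b'" "h \<in> Inn C I a'" "k \<in> Inn C I b'" "g = k \<cdot> f \<cdot> h"
    by (auto simp: inner_equiv_def)
  \<comment> \<open>The objects hidden in \<open>inner_equiv\<close> are \<open>a\<close> and
    \<open>b\<close>, because hom-sets are disjoint.\<close>
  then have h: "h \<in> Inn C I a" and k: "k \<in> Inn C I b" and g: "g = k \<cdot> f \<cdot> h"
    using Hom_unique[OF f] by auto
  have a: "a \<in> Obj C" and b: "b \<in> Obj C"
    using Hom_Obj[OF f] by auto
  obtain k' where k': "k' \<in> Inn C I b" "f \<cdot> h = k' \<cdot> f"
    using Inn_move[OF f h] by blast
  have "g = (k \<cdot> k') \<cdot> f"
    using g k'(2) Comp_assoc[OF Inn_Hom[OF a h] f Inn_Hom[OF b k]]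
      Comp_assoc[OF f Inn_Hom[OF b k'(1)] Inn_Hom[OF b k]] by simp
  then show "\<exists>k\<in>Inn C I b. g = k \<cdot> f"
    using Inn_Comp[OF b k k'(1)] by blast
next
  assume "\<exists>k\<in>Inn C I b. g = k \<cdot> f"
  then obtain k where k: "k \<in> Inn C I b" "g = k \<cdot> f" by blast
  have a: "a \<in> Obj C" and b: "b \<in> Obj C"
    using Hom_Obj[OF f] by auto
  have g: "g \<in> Hom C a b"
    using k Comp_Hom[OF f Inn_Hom[OF b]] by simp
  \<comment> \<open>The two-sided form of the definition is met with the identity as inner factor at
    the source.\<close>
  have "g = k \<cdot> f \<cdot> Ident C a"
    using Comp_Ident_right[OF g] k(2) by simp
  then show "(f, g) \<in> inner_equiv C I"
    using a b f g k(1) Inn_Ident[OF a] unfolding inner_equiv_def by blast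
qed

lemma inner_class_eq:
  assumes "f \<in> Hom C a b"
  shows "inner_class C I f = {k \<cdot> f | k. k \<in> Inn C I b}"
  using inner_equiv_iff[OF assms] by (auto simp: inner_class_def)

text \<open>By the one-sided description, the classes in a hom-set into \<open>b\<close> are the
  orbits of the group \<open>Inn C I b\<close> acting by composition on the left. Reflexivity,
  symmetry and transitivity thus come from its identity, inverses and products.\<close>

lemma equiv_inner_equiv: "equiv (Mor C) (inner_equiv C I)"
proof (rule equivI)
  show "inner_equiv C I \<subseteq> Mor C \<times> Mor C"
    by (auto simp: inner_equiv_def Mor_def)
  show "refl_on (Mor C) (inner_equiv C I)"
  proof (rule refl_onI)
    fix f assume "f \<in> Mor C"
    then obtain a b where f: "f \<in> Hom C a b" by (auto simp: Mor_def)
    then show "(f, f) \<in> inner_equiv C I"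
      using inner_equiv_iff[OF f] Inn_Ident Hom_Obj[OF f] Comp_Ident_left[OF f] by metis
  qed
  show "sym (inner_equiv C I)"
  proof (rule symI)
    fix f g assume fg: "(f, g) \<in> inner_equiv C I"
    then obtain a b where f: "f \<in> Hom C a b" and g: "g \<in> Hom C a b"
      by (auto simp: inner_equiv_def)
    obtain k where k: "k \<in> Inn C I b" "g = k \<cdot> f"
      using fg inner_equiv_iff[OF f] by blast
    have b: "b \<in> Obj C" using Hom_Obj[OF f] by simp
    obtain k' where k': "k' \<in> Inn C I b" "k' \<cdot> k = Ident C b"
      using Inn_inverse[OF b k(1)] .
    have "f = k' \<cdot> g"
      using Comp_assoc[OF f Inn_Hom[OF b k(1)] Inn_Hom[OF b k'(1)]] k(2) k'(2)
        Comp_Ident_left[OF f] by simp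
    then show "(g, f) \<in> inner_equiv C I"
      using inner_equiv_iff[OF g] k'(1) by blast
  qed
  show "trans (inner_equiv C I)"
  proof (rule transI)
    fix f g h assume fg: "(f, g) \<in> inner_equiv C I" and gh: "(g, h) \<in> inner_equiv C I"
    from fg obtain a b where f: "f \<in> Hom C a b" and g: "g \<in> Hom C a b"
      by (auto simp: inner_equiv_def)
    have b: "b \<in> Obj C" using Hom_Obj[OF f] by simp
    obtain k l where k: "k \<in> Inn C I b" "g = k \<cdot> f" and l: "l \<in> Inn C I b" "h = l \<cdot> g"
      using fg gh inner_equiv_iff[OF f] inner_equiv_iff[OF g] by blast
    have "h = (l \<cdot> k) \<cdot> f"
      using Comp_assoc[OF f Inn_Hom[OF b k(1)] Inn_Hom[OF b l(1)]] k l by simp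
    then show "(f, h) \<in> inner_equiv C I"
      using inner_equiv_iff[OF f] Inn_Comp[OF b l(1) k(1)] by blast
  qed
qed

lemma inner_class_self:
  assumes "f \<in> Hom C a b"
  shows "f \<in> inner_class C I f"
  unfolding inner_class_def
  by (rule equiv_class_self[OF equiv_inner_equiv])
    (use assms Hom_Obj[OF assms] in \<open>auto simp: Mor_def\<close>)

lemma class_prod_inner_class:
  assumes f: "f \<in> Hom C a b" and g: "g \<in> Hom C b c"
  shows "class_prod C (inner_class C I g) (inner_class C I f) = inner_class C I (g \<cdot> f)"
proof -
  have b: "b \<in> Obj C" and c: "c \<in> Obj C"
    using Hom_Obj[OF g] by auto
  have gf: "g \<cdot> f \<in> Hom C a c" using Comp_Hom[OF f g] .
  show ?thesis
  proof (intro equalityI subsetI)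
    fix x assume "x \<in> class_prod C (inner_class C I g) (inner_class C I f)"
    then obtain k l where k: "k \<in> Inn C I c" and l: "l \<in> Inn C I b" and x: "x = (k \<cdot> g) \<cdot> (l \<cdot> f)"
      unfolding class_prod_def inner_class_eq[OF f] inner_class_eq[OF g] by blast
    \<comment> \<open>The inner factor \<open>l\<close> stuck between \<open>g\<close> and
      \<open>f\<close> is moved past \<open>g\<close>, where it merges with
      \<open>k\<close>.\<close>
    obtain m where m: "m \<in> Inn C I c" "g \<cdot> l = m \<cdot> g"
      using Inn_move[OF g l] by blast
    note kH = Inn_Hom[OF c k] and lH = Inn_Hom[OF b l] and mH = Inn_Hom[OF c m(1)]
    have "x = k \<cdot> ((g \<cdot> l) \<cdot> f)"
      using x Comp_assoc[OF Comp_Hom[OF f lH] g kH] Comp_assoc[OF f lH g] by simp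
    also have "\<dots> = (k \<cdot> m) \<cdot> (g \<cdot> f)"
      using m(2) Comp_assoc[OF f g mH] Comp_assoc[OF gf mH kH] by simp
    finally show "x \<in> inner_class C I (g \<cdot> f)"
      using Inn_Comp[OF c k m(1)] unfolding inner_class_eq[OF gf] by blast
  next
    fix x assume "x \<in> inner_class C I (g \<cdot> f)"
    then obtain k where k: "k \<in> Inn C I c" "x = k \<cdot> (g \<cdot> f)"
      unfolding inner_class_eq[OF gf] by blast
    \<comment> \<open>The whole inner factor can be absorbed into \<open>g\<close>, with
      \<open>f\<close> representing its own class.\<close>
    have "x = (k \<cdot> g) \<cdot> f"
      using k(2) Comp_assoc[OF f g Inn_Hom[OF c k(1)]] by simp
    moreover have "k \<cdot> g \<in> inner_class C I g"
      using k(1) unfolding inner_class_eq[OF g] by blast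
    ultimately show "x \<in> class_prod C (inner_class C I g) (inner_class C I f)"
      using inner_class_self[OF f] unfolding class_prod_def by blast
  qed
qed

section \<open>The quotient category\<close>

lemma Obj_Out [simp]: "Obj (Out C I) = Obj C"
  and Ident_Out [simp]: "Ident (Out C I) a = inner_class C I (Ident C a)"
  and Comp_Out: "G \<cdot>\<^bsub>Out C I\<^esub> F = class_prod C G F"
  and Hom_Out: "Hom (Out C I) a b = inner_class C I ` Hom C a b"
  by (auto simp: Out_def quotient_def inner_class_def)

lemma Comp_Out_inner_class:
  "f \<in> Hom C a b \<Longrightarrow> g \<in> Hom C b c \<Longrightarrow>
    inner_class C I g \<cdot>\<^bsub>Out C I\<^esub> inner_class C I f = inner_class C I (g \<cdot> f)"
  by (simp add: Comp_Out class_prod_inner_class)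

text \<open>Classes never cross hom-sets, so a class determines its domain and codomain, as the
  quotient category requires.\<close>

lemma inner_class_Hom:
  assumes f: "f \<in> Hom C a b" and g: "g \<in> inner_class C I f"
  shows "g \<in> Hom C a b"
  using g Comp_Hom[OF f Inn_Hom] Hom_Obj[OF f] unfolding inner_class_eq[OF f] by auto

text \<open>Once representatives are chosen, \<open>Comp_Out_inner_class\<close> reduces the
  identity and associativity laws to those of \<open>C\<close>.\<close>

lemma category_Out: "category (Out C I)"
proof
  fix a b F assume "F \<in> Hom (Out C I) a b"
  then obtain f where f: "f \<in> Hom C a b" "F = inner_class C I f" by (auto simp: Hom_Out)
  show "a \<in> Obj (Out C I) \<and> b \<in> Obj (Out C I)"
    using Hom_Obj[OF f(1)] by simp
  show "F \<cdot>\<^bsub>Out C I\<^esub> Ident (Out C I) a = F"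
    using f Comp_Out_inner_class[OF Ident_Hom] Hom_Obj Comp_Ident_right by auto
  show "Ident (Out C I) b \<cdot>\<^bsub>Out C I\<^esub> F = F"
    using f Comp_Out_inner_class[OF _ Ident_Hom] Hom_Obj Comp_Ident_left by auto
next
  fix a b a' b' F assume "F \<in> Hom (Out C I) a b" "F \<in> Hom (Out C I) a' b'"
  then obtain f g where f: "f \<in> Hom C a b" "F = inner_class C I f"
    and g: "g \<in> Hom C a' b'" "F = inner_class C I g" by (auto simp: Hom_Out)
  have "g \<in> Hom C a b"
    using inner_class_Hom[OF f(1)] inner_class_self[OF g(1)] f(2) g(2) by simp
  then show "a = a' \<and> b = b'" using Hom_unique g(1) by blast
next
  fix a assume "a \<in> Obj (Out C I)"
  then show "Ident (Out C I) a \<in> Hom (Out C I) a a"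
    using Ident_Hom by (auto simp: Hom_Out)
next
  fix a b c F G assume "F \<in> Hom (Out C I) a b" "G \<in> Hom (Out C I) b c"
  then show "G \<cdot>\<^bsub>Out C I\<^esub> F \<in> Hom (Out C I) a c"
    using Comp_Out_inner_class Comp_Hom by (fastforce simp: Hom_Out)
next
  fix a b c d F G H
  assume "F \<in> Hom (Out C I) a b" "G \<in> Hom (Out C I) b c" "H \<in> Hom (Out C I) c d"
  then obtain f g h where f: "f \<in> Hom C a b" "F = inner_class C I f"
    and g: "g \<in> Hom C b c" "G = inner_class C I g"
    and h: "h \<in> Hom C c d" "H = inner_class C I h" by (auto simp: Hom_Out)
  show "(H \<cdot>\<^bsub>Out C I\<^esub> G) \<cdot>\<^bsub>Out C I\<^esub> F = H \<cdot>\<^bsub>Out C I\<^esub> (G \<cdot>\<^bsub>Out C I\<^esub> F)"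
    using Comp_assoc[OF f(1) g(1) h(1)] f(2) g(2) h(2)
    by (simp add: Comp_Out_inner_class[OF f(1) g(1)] Comp_Out_inner_class[OF g(1) h(1)]
        Comp_Out_inner_class[OF f(1) Comp_Hom[OF g(1) h(1)]]
        Comp_Out_inner_class[OF Comp_Hom[OF f(1) g(1)] h(1)])
qed

section \<open>Lifting isomorphisms from the quotient\<close>

lemma left_inverse_if_class:
  assumes f: "f \<in> Hom C a b" and g: "g \<in> Hom C b a"
    and eq: "inner_class C I g \<cdot>\<^bsub>Out C I\<^esub> inner_class C I f = Ident (Out C I) a"
  obtains k where "k \<in> Inn C I a" "(k \<cdot> g) \<cdot> f = Ident C a"
proof -
  have a: "a \<in> Obj C" using Hom_Obj[OF f] by simp
  have gf: "g \<cdot> f \<in> Hom C a a" using Comp_Hom[OF f g] .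
  \<comment> \<open>The identity lies in its own class, which \<open>eq\<close> equates with that of
    \<open>g \<cdot> f\<close>.\<close>
  have "Ident C a \<in> inner_class C I (g \<cdot> f)"
    using eq inner_class_self[OF Ident_Hom[OF a]] Comp_Out_inner_class[OF f g] by simp
  then obtain k where k: "k \<in> Inn C I a" "Ident C a = k \<cdot> (g \<cdot> f)"
    unfolding inner_class_eq[OF gf] by blast
  then have "(k \<cdot> g) \<cdot> f = Ident C a"
    using Comp_assoc[OF f g Inn_Hom[OF a]] by simp
  with k(1) show thesis by (rule that)
qed

text \<open>Not the mirror image of the left case: an inner factor collected on the left would stand
  before \<open>f\<close> and give no right inverse. Instead \<open>f \<cdot> g\<close> is
  recognised as an inner automorphism, and its inverse is put to the right of
  \<open>g\<close>.\<close>

lemma right_inverse_if_class: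
  assumes f: "f \<in> Hom C a b" and g: "g \<in> Hom C b a"
    and eq: "inner_class C I f \<cdot>\<^bsub>Out C I\<^esub> inner_class C I g = Ident (Out C I) b"
  obtains g' where "g' \<in> Hom C b a" "f \<cdot> g' = Ident C b"
proof -
  have b: "b \<in> Obj C" using Hom_Obj[OF f] by simp
  have fg: "f \<cdot> g \<in> Hom C b b" using Comp_Hom[OF g f] .
  have "f \<cdot> g \<in> inner_class C I (Ident C b)"
    using eq inner_class_self[OF fg] Comp_Out_inner_class[OF g f] by simp
  then obtain k where k: "k \<in> Inn C I b" "f \<cdot> g = k \<cdot> Ident C b"
    unfolding inner_class_eq[OF Ident_Hom[OF b]] by blast
  have fgk: "f \<cdot> g = k"
    using k(2) Comp_Ident_right[OF Inn_Hom[OF b k(1)]] by simp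
  obtain k' where k': "k' \<in> Inn C I b" "k \<cdot> k' = Ident C b"
    using Inn_inverse[OF b k(1)] .
  note k'H = Inn_Hom[OF b k'(1)]
  have "f \<cdot> (g \<cdot> k') = Ident C b"
    using Comp_assoc[OF k'H g f] fgk k'(2) by simp
  with Comp_Hom[OF k'H g] show thesis by (rule that)
qed

lemma isomorphic_if_isomorphic_Out:
  assumes "isomorphic (Out C I) a b"
  shows "isomorphic C a b"
proof -
  obtain F G where "F \<in> Hom (Out C I) a b" "G \<in> Hom (Out C I) b a"
    and GF: "G \<cdot>\<^bsub>Out C I\<^esub> F = Ident (Out C I) a" and FG: "F \<cdot>\<^bsub>Out C I\<^esub> G = Ident (Out C I) b"
    using assms unfolding isomorphic_def Iso_def by blast
  then obtain f g where f: "f \<in> Hom C a b" "F = inner_class C I f"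
    and g: "g \<in> Hom C b a" "G = inner_class C I g" by (auto simp: Hom_Out)
  obtain k where k: "k \<in> Inn C I a" "(k \<cdot> g) \<cdot> f = Ident C a"
    using left_inverse_if_class[OF f(1) g(1)] GF f(2) g(2) by metis
  obtain g' where g': "g' \<in> Hom C b a" "f \<cdot> g' = Ident C b"
    using right_inverse_if_class[OF f(1) g(1)] FG f(2) g(2) by metis
  have "k \<cdot> g \<in> Hom C b a"
    using Comp_Hom[OF g(1) Inn_Hom] k(1) Hom_Obj[OF f(1)] by simp
  \<comment> \<open>The left inverse \<open>k \<cdot> g\<close> and the right inverse
    \<open>g'\<close> were obtained independently.\<close>
  then have "f \<in> Iso C a b"
    using Iso_if_left_right_inverse f(1) g' k(2) by blast
  then show ?thesis by (auto simp: isomorphic_def)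
qed

lemma classification_functor_Out:
  "classification_functor C (Out C I) (\<lambda>a. a) (inner_class C I)"
proof -
  interpret out: category "Out C I" by (rule category_Out)
  show ?thesis
  proof
    fix a b c f g assume "f \<in> Hom C a b" "g \<in> Hom C b c"
    then show "inner_class C I (g \<cdot> f) = inner_class C I g \<cdot>\<^bsub>Out C I\<^esub> inner_class C I f"
      by (simp add: Comp_Out_inner_class)
  qed (auto simp: Hom_Out isomorphic_if_isomorphic_Out)
qed

end

theorem theorem1:
  fixes C :: "('o, 'm) cat" and I :: "'o \<Rightarrow> 'm set"
  assumes "category C"
    and "\<And>a. a \<in> Obj C \<Longrightarrow> I a \<subseteq> carrier (Aut C a)"
    and "inner_axiom C I"
  shows "(inner_axiom C (Inn C I) \<and> (\<forall>a\<in>Obj C. Inn C I a \<lhd> Aut C a)) \<and>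
    (equiv (Mor C) (inner_equiv C I) \<and>
     (\<forall>a\<in>Obj C. \<forall>b\<in>Obj C. \<forall>c\<in>Obj C. \<forall>f\<in>Hom C a b. \<forall>g\<in>Hom C b c.
        class_prod C (inner_class C I g) (inner_class C I f) = inner_class C I (g \<cdot>\<^bsub>C\<^esub> f)) \<and>
     category (Out C I) \<and>
     classification_functor C (Out C I) (\<lambda>a. a) (inner_class C I) \<and>
     classifying_category C (Out C I))"
proof -
  interpret inner_category C I
    using assms by (simp add: inner_category_def inner_category_axioms_def)
  show ?thesis
    using inner_axiom_Inn normal_Inn equiv_inner_equiv class_prod_inner_class category_Out
      classification_functor_Out unfolding classifying_category_def by blast
qed

end
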